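(* Let $(\Omega,\Sigma,\mathbb{P})$ be a probability space and let $b$ be a normalizing function with index $\alpha>0$. Then the non-zero equivalence classes of $\mathbb{W}_b=\mathbb{V}_b/\mathcal{N}_b$ are equivalence classes of regularly varying random variables.
   Context: A measurable function $L:(0,\infty)\to(0,\infty)$ is slowly varying if $\lim_{s\to\infty} L(sx)/L(s)=1$ for all $x>0$. A normalizing function with index $\alpha>0$ is a function $b(s)=s^{\alpha}L(s)$ with $L$ slowly varying. Let $L^0(\Omega,\Sigma,\mathbb{P})$ be the collection of all real-valued random variables on $\Omega$. Define $$\mathbb{V}_b=\Big\{X\in L^0(\Omega,\Sigma,\mathbb{P}) : \forall x>0,\ \lim_{s\to\infty} b(s)\mathbb{P}(X>sx)<\infty \text{ and } \lim_{s\to\infty} b(s)\mathbb{P}(X<-sx)<\infty\Big\},$$ i.e. for every $x>0$ both limits exist and are finite. A random variable $X$ is trivially normalized by $b$ if for all $x>0$, $\lim_{s\to\infty} b(s)\mathbb{P}(X>sx)=0$ and $\lim_{s\to\infty} b(s)\mathbb{P}(X<-sx)=0$. The set $\mathcal{N}_b$ consists of all $X\in\mathbb{V}_b$ that are trivially normalized by $b$. For $X,Y\in\mathbb{V}_b$, $X\sim_b Y$ if and only if $X-Y\in\mathcal{N}_b$, and $\mathbb{W}_b=\mathbb{V}_b/\mathcal{N}_b$ is the quotient space of equivalence classes; its zero element is the class $\mathcal{N}_b$. A real-valued random variable $X$ is regularly varying with tail index $\alpha>0$ if there exist a regularly varying function $b(s)=s^{\alpha}L_b(s)$ ($L_b$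 slowly varying) and real numbers $\kappa_+,\kappa_-\ge 0$ with $\kappa_++\kappa_->0$ such that for all $x>0$, $\lim_{s\to\infty} b(s)\mathbb{P}(X>sx)=\kappa_+x^{-\alpha}$ and $\lim_{s\to\infty} b(s)\mathbb{P}(X<-sx)=\kappa_-x^{-\alpha}$. *)

theory Defs
  imports "HOL-Probability.Probability"
begin

text \<open>Functions on the positive half-line are modelled by total functions on the reals of which
  only the values at positive arguments matter.\<close>

definition slowly_varying :: "(real \<Rightarrow> real) \<Rightarrow> bool" where
  "slowly_varying L \<longleftrightarrow>
     L \<in> borel_measurable (restrict_space borel {0<..}) \<and>
     (\<forall>s>0. L s > 0) \<and>
     (\<forall>x>0. ((\<lambda>s. L (s * x) / L s) \<longlongrightarrow> 1) at_top)"

definition normalizing_function :: "real \<Rightarrow> (real \<Rightarrow> real) \<Rightarrow> bool" where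
  "normalizing_function \<alpha> b \<longleftrightarrow>
     \<alpha> > 0 \<and> (\<exists>L. slowly_varying L \<and> (\<forall>s>0. b s = s powr \<alpha> * L s))"

definition upper_tail :: "'a measure \<Rightarrow> ('a \<Rightarrow> real) \<Rightarrow> real \<Rightarrow> real" where
  "upper_tail M X t = measure M {\<omega> \<in> space M. X \<omega> > t}"

definition lower_tail :: "'a measure \<Rightarrow> ('a \<Rightarrow> real) \<Rightarrow> real \<Rightarrow> real" where
  "lower_tail M X t = measure M {\<omega> \<in> space M. X \<omega> < - t}"

text \<open>Random variables are functions here, not classes modulo almost sure equality. The limits
  below are limits in the reals, hence finite.\<close>

definition V_space :: "'a measure \<Rightarrow> (real \<Rightarrow> real) \<Rightarrow> ('a \<Rightarrow> real) set" where
  "V_space M b = {X \<in> borel_measurable M. \<forall>x>0.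
     (\<exists>l. ((\<lambda>s. b s * upper_tail M X (s * x)) \<longlongrightarrow> l) at_top) \<and>
     (\<exists>l. ((\<lambda>s. b s * lower_tail M X (s * x)) \<longlongrightarrow> l) at_top)}"

definition trivially_normalized :: "'a measure \<Rightarrow> (real \<Rightarrow> real) \<Rightarrow> ('a \<Rightarrow> real) \<Rightarrow> bool" where
  "trivially_normalized M b X \<longleftrightarrow> (\<forall>x>0.
     ((\<lambda>s. b s * upper_tail M X (s * x)) \<longlongrightarrow> 0) at_top \<and>
     ((\<lambda>s. b s * lower_tail M X (s * x)) \<longlongrightarrow> 0) at_top)"

definition N_space :: "'a measure \<Rightarrow> (real \<Rightarrow> real) \<Rightarrow> ('a \<Rightarrow> real) set" where
  "N_space M b = {X \<in> V_space M b. trivially_normalized M b X}"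

definition sim_rel :: "'a measure \<Rightarrow> (real \<Rightarrow> real) \<Rightarrow> (('a \<Rightarrow> real) \<times> ('a \<Rightarrow> real)) set" where
  "sim_rel M b = {(X, Y). X \<in> V_space M b \<and> Y \<in> V_space M b \<and> (\<lambda>\<omega>. X \<omega> - Y \<omega>) \<in> N_space M b}"

definition W_space :: "'a measure \<Rightarrow> (real \<Rightarrow> real) \<Rightarrow> ('a \<Rightarrow> real) set set" where
  "W_space M b = V_space M b // sim_rel M b"

definition regularly_varying :: "'a measure \<Rightarrow> real \<Rightarrow> ('a \<Rightarrow> real) \<Rightarrow> bool" where
  "regularly_varying M \<alpha> X \<longleftrightarrow>
     X \<in> borel_measurable M \<and>
     (\<exists>b \<kappa>\<^sub>p \<kappa>\<^sub>m. normalizing_function \<alpha> b \<and> \<kappa>\<^sub>p \<ge> 0 \<and> \<kappa>\<^sub>m \<ge> 0 \<and> \<kappa>\<^sub>p + \<kappa>\<^sub>m > 0 \<and>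
       (\<forall>x>0.
          ((\<lambda>s. b s * upper_tail M X (s * x)) \<longlongrightarrow> \<kappa>\<^sub>p * x powr (- \<alpha>)) at_top \<and>
          ((\<lambda>s. b s * lower_tail M X (s * x)) \<longlongrightarrow> \<kappa>\<^sub>m * x powr (- \<alpha>)) at_top))"

end

(*
  Replacing s by s * x in the limit at x = 1 multiplies it by lim b s / b (s * x) = x powr -\<alpha>, so
  every member of V_space M b has limits of the form \<kappa> * x powr -\<alpha>, with \<kappa> the limits at x = 1; it
  is regularly varying unless both vanish, in which case it lies in N_space M b. As N_space M b is
  closed under differences, a class that meets N_space M b equals it.
*)
theory Submission
  imports Defs
begin

lemma normalizing_function_pos:
  assumes "normalizing_function \<alpha> b" "s > 0"
  shows "b s > 0"
  using assms by (auto simp: normalizing_function_def slowly_varying_def)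

text \<open>Substituting \<open>s * x\<close> for \<open>s\<close> in the given limit leaves only
  \<open>b (s * x)\<close> to be compared with \<open>b s\<close>, and slow variation controls that
  ratio. \<open>f\<close> is arbitrary so that it can be either tail.\<close>

lemma normalizing_function_tendsto_scale:
  fixes f :: "real \<Rightarrow> real"
  assumes b: "normalizing_function \<alpha> b" and f: "((\<lambda>s. b s * f s) \<longlongrightarrow> l) at_top" and x: "x > 0"
  shows "((\<lambda>s. b s * f (s * x)) \<longlongrightarrow> l * x powr (- \<alpha>)) at_top"
proof -
  obtain L where L: "slowly_varying L" and bL: "\<And>s. s > 0 \<Longrightarrow> b s = s powr \<alpha> * L s"
    using b by (auto simp: normalizing_function_def)
  have "filterlim (\<lambda>s. s * x) at_top at_top"
    using x by (intro filterlim_at_top_mult_tendsto_pos[OF tendsto_const _ filterlim_ident]) auto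
  from filterlim_compose[OF f this]
  have "((\<lambda>s. b (s * x) * f (s * x)) \<longlongrightarrow> l) at_top" .
  moreover have "((\<lambda>s. L (s * x) / L s) \<longlongrightarrow> 1) at_top"
    using L x by (simp add: slowly_varying_def)
  \<comment> \<open>The extra factors turn \<open>b (s * x)\<close> into exactly \<open>b s\<close>
    for positive \<open>s\<close>, since
    \<open>b (s * x) = s powr \<alpha> * x powr \<alpha> * L (s * x)\<close>.\<close>
  ultimately have "((\<lambda>s. b (s * x) * f (s * x) * x powr (- \<alpha>) / (L (s * x) / L s))
      \<longlongrightarrow> l * x powr (- \<alpha>) / 1) at_top"
    by (intro tendsto_intros) auto
  moreover have "\<forall>\<^sub>F s in at_top.
      b (s * x) * f (s * x) * x powr (- \<alpha>) / (L (s * x) / L s) = b s * f (s * x)"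
    using eventually_gt_at_top[of 0]
  proof eventually_elim
    case (elim s)
    have "L s > 0" "L (s * x) > 0"
      using L elim x by (simp_all add: slowly_varying_def)
    then show ?case
      using elim x by (simp add: bL powr_mult powr_minus field_simps)
  qed
  ultimately show ?thesis
    by (simp add: tendsto_cong)
qed

text \<open>A limit equal to 0 is in particular a finite limit, so trivial normalization already
  forces membership in \<open>V_space\<close>.\<close>

lemma N_space_eq:
  "N_space M b = {X \<in> borel_measurable M. trivially_normalized M b X}"
  unfolding N_space_def V_space_def trivially_normalized_def by auto

lemma regularly_varying_if_not_N_space:
  assumes b: "normalizing_function \<alpha> b" and X: "X \<in> V_space M b" "X \<notin> N_space M b"
  shows "regularly_varying M \<alpha> X"
proof -
  have meas: "X \<in> borel_measurable M"
    using X by (simp add: V_space_def)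
  obtain l m where l: "((\<lambda>s. b s * upper_tail M X s) \<longlongrightarrow> l) at_top"
    and m: "((\<lambda>s. b s * lower_tail M X s) \<longlongrightarrow> m) at_top"
    using X(1) by (auto simp: V_space_def dest!: spec[of _ 1])
  note lim = normalizing_function_tendsto_scale[OF b l] normalizing_function_tendsto_scale[OF b m]
  have "\<forall>\<^sub>F s in at_top. 0 \<le> b s"
    using eventually_gt_at_top[of 0] by eventually_elim (simp add: normalizing_function_pos[OF b] less_imp_le)
  then have "\<forall>\<^sub>F s in at_top. 0 \<le> b s * upper_tail M X s" "\<forall>\<^sub>F s in at_top. 0 \<le> b s * lower_tail M X s"
    by (auto elim!: eventually_mono simp: upper_tail_def lower_tail_def)
  then have nonneg: "l \<ge> 0" "m \<ge> 0"
    using tendsto_lowerbound[OF l] tendsto_lowerbound[OF m] by auto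
  \<comment> \<open>If both constants vanished, \<open>lim\<close> would give the limit 0 for both
    tails at every \<open>x > 0\<close>.\<close>
  moreover have "l + m > 0"
  proof (rule ccontr)
    assume "\<not> l + m > 0"
    then have "l = 0" "m = 0"
      using nonneg by auto
    then have "trivially_normalized M b X"
      using lim by (simp add: trivially_normalized_def)
    then show False
      using X meas by (simp add: N_space_eq)
  qed
  \<comment> \<open>The given \<open>b\<close> serves as the normalizing function, with
    \<open>l\<close> and \<open>m\<close> as the two constants.\<close>
  ultimately show ?thesis
    unfolding regularly_varying_def using meas b lim by blast
qed

text \<open>By this symmetry only upper tails of differences have to be estimated.\<close>

lemma lower_tail_diff: "lower_tail M (\<lambda>\<omega>. X \<omega> - Y \<omega>) t = upper_tail M (\<lambda>\<omega>. Y \<omega> - X \<omega>) t"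
  unfolding lower_tail_def upper_tail_def by (rule arg_cong[where f = "measure M"]) auto

text \<open>A difference above \<open>t\<close> forces \<open>X > t / 2\<close> or
  \<open>Y < - (t / 2)\<close>; the union bound does the rest.\<close>

lemma (in finite_measure) upper_tail_diff_le:
  assumes [measurable]: "X \<in> borel_measurable M" "Y \<in> borel_measurable M"
  shows "upper_tail M (\<lambda>\<omega>. X \<omega> - Y \<omega>) t \<le> upper_tail M X (t / 2) + lower_tail M Y (t / 2)"
proof -
  have "upper_tail M (\<lambda>\<omega>. X \<omega> - Y \<omega>) t
      \<le> measure M ({\<omega> \<in> space M. X \<omega> > t / 2} \<union> {\<omega> \<in> space M. Y \<omega> < - (t / 2)})"
    unfolding upper_tail_def by (rule finite_measure_mono) auto
  also have "\<dots> \<le> upper_tail M X (t / 2) + lower_tail M Y (t / 2)"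
    unfolding upper_tail_def lower_tail_def by (rule measure_Un_le) auto
  finally show ?thesis .
qed

text \<open>Halving the threshold \<open>s * x\<close> amounts to replacing \<open>x\<close> by
  \<open>x / 2\<close>, which is still positive, so both terms of the union bound vanish in the
  limit.\<close>

lemma (in finite_measure) upper_tail_diff_tendsto_0:
  assumes X: "X \<in> N_space M b" and Y: "Y \<in> N_space M b"
    and b: "\<And>s. s > 0 \<Longrightarrow> b s > 0" and x: "x > 0"
  shows "((\<lambda>s. b s * upper_tail M (\<lambda>\<omega>. X \<omega> - Y \<omega>) (s * x)) \<longlongrightarrow> 0) at_top"
proof (rule tendsto_sandwich[where f = "\<lambda>_. 0"])
  have lim: "((\<lambda>s. b s * upper_tail M X (s * (x / 2))) \<longlongrightarrow> 0) at_top"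
    "((\<lambda>s. b s * lower_tail M Y (s * (x / 2))) \<longlongrightarrow> 0) at_top"
    using X Y x half_gt_zero[OF x] by (auto simp only: N_space_eq trivially_normalized_def mem_Collect_eq)
  show "((\<lambda>s. b s * upper_tail M X (s * (x / 2)) + b s * lower_tail M Y (s * (x / 2))) \<longlongrightarrow> 0) at_top"
    using tendsto_add[OF lim] by simp
  show "\<forall>\<^sub>F s in at_top. b s * upper_tail M (\<lambda>\<omega>. X \<omega> - Y \<omega>) (s * x)
      \<le> b s * upper_tail M X (s * (x / 2)) + b s * lower_tail M Y (s * (x / 2))"
    using eventually_gt_at_top[of 0]
  proof eventually_elim
    case (elim s)
    show ?case
      using mult_left_mono[OF upper_tail_diff_le[of X Y "s * x"] less_imp_le[OF b[OF elim]]] X Y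
      by (simp add: N_space_eq distrib_left)
  qed
  show "\<forall>\<^sub>F s in at_top. 0 \<le> b s * upper_tail M (\<lambda>\<omega>. X \<omega> - Y \<omega>) (s * x)"
    using eventually_gt_at_top[of 0]
    by eventually_elim (simp add: b less_imp_le upper_tail_def)
qed simp

lemma (in finite_measure) N_space_diff:
  assumes "X \<in> N_space M b" "Y \<in> N_space M b" "\<And>s. s > 0 \<Longrightarrow> b s > 0"
  shows "(\<lambda>\<omega>. X \<omega> - Y \<omega>) \<in> N_space M b"
  using upper_tail_diff_tendsto_0[OF assms(1,2)] upper_tail_diff_tendsto_0[OF assms(2,1)] assms
  by (auto simp: N_space_eq trivially_normalized_def lower_tail_diff)

text \<open>Closure under differences yields sums: \<open>X = Y - (0 - (X - Y))\<close>, where the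
  zero function is obtained as \<open>Y - Y\<close>.\<close>

lemma (in finite_measure) N_space_diff_cancel:
  assumes Y: "Y \<in> N_space M b" and XY: "(\<lambda>\<omega>. X \<omega> - Y \<omega>) \<in> N_space M b"
    and b: "\<And>s. s > 0 \<Longrightarrow> b s > 0"
  shows "X \<in> N_space M b"
proof -
  have "(\<lambda>\<omega>. Y \<omega> - Y \<omega>) \<in> N_space M b"
    by (rule N_space_diff[OF Y Y b])
  from N_space_diff[OF this XY b] have "(\<lambda>\<omega>. Y \<omega> - X \<omega>) \<in> N_space M b"
    by simp
  from N_space_diff[OF Y this b] show ?thesis
    by simp
qed

text \<open>One inclusion writes \<open>Y = X - (X - Y)\<close>; the other is closure under
  differences.\<close>

lemma (in finite_measure) sim_rel_class_eq_N_space: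
  assumes X: "X \<in> N_space M b" and b: "\<And>s. s > 0 \<Longrightarrow> b s > 0"
  shows "sim_rel M b `` {X} = N_space M b"
proof
  show "sim_rel M b `` {X} \<subseteq> N_space M b"
  proof
    fix Y assume "Y \<in> sim_rel M b `` {X}"
    then have "(\<lambda>\<omega>. X \<omega> - Y \<omega>) \<in> N_space M b"
      by (simp add: sim_rel_def)
    from N_space_diff[OF X this b] show "Y \<in> N_space M b"
      by simp
  qed
  show "N_space M b \<subseteq> sim_rel M b `` {X}"
    using N_space_diff[OF X _ b] X by (auto simp: sim_rel_def N_space_def)
qed

theorem theorem1:
  fixes M :: "'a measure" and b :: "real \<Rightarrow> real" and \<alpha> :: real
  assumes "prob_space M"
    and "normalizing_function \<alpha> b"
  shows "\<forall>C \<in> W_space M b. C \<noteq> N_space M b \<longrightarrow> (\<forall>X \<in> C. regularly_varying M \<alpha> X)"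
proof (intro ballI impI)
  fix C X assume C: "C \<in> W_space M b" "C \<noteq> N_space M b" and X: "X \<in> C"
  interpret prob_space M by fact
  note pos = normalizing_function_pos[OF assms(2)]
  obtain Z where Z: "C = sim_rel M b `` {Z}"
    using C(1) by (auto simp: W_space_def quotient_def)
  have XV: "X \<in> V_space M b" and ZX: "(\<lambda>\<omega>. Z \<omega> - X \<omega>) \<in> N_space M b"
    using X by (auto simp: Z sim_rel_def)
  \<comment> \<open>\<open>X\<close> may differ from the representative \<open>Z\<close>, so
    membership is first carried over to \<open>Z\<close>, whose class would then be the zero
    class.\<close>
  have "X \<notin> N_space M b"
  proof
    assume "X \<in> N_space M b"
    from N_space_diff_cancel[OF this ZX pos] have "Z \<in> N_space M b" .
    from sim_rel_class_eq_N_space[OF this pos] show False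
      using C(2) Z by simp
  qed
  then show "regularly_varying M \<alpha> X"
    by (rule regularly_varying_if_not_N_space[OF assms(2) XV])
qed

end
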